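(* Let $m\in\{1,2\}$, $K>0$, $\gamma=3$, and let $(\rho,u)$ be a classical (smooth, $\rho>0$) solution of the radially symmetric isentropic compressible Euler equations $$(r^m\rho)_t+(r^m\rho u)_r=0,\qquad (r^m\rho u)_t+(r^m\rho u^2)_r+r^m p_r=0,\qquad p=K\rho^\gamma,$$ with characteristic speeds $c_1=u-h$, $c_2=u+h$, where $h=\sqrt{K\gamma}\,\rho^{(\gamma-1)/2}$. Let $\Omega=[a,b]\subset(0,\infty)$ and suppose $c_1(\cdot,0),c_2(\cdot,0)\in C^1(\Omega)$, $c_1(r,0)>0$ for all $r\in\Omega$, and $c_1,c_2\in C^1(D(\Omega,T))$ for some $T>0$. Then for all $(r,t)\in D(\Omega,T)$, $$c_1(r,t)\ \ge\ \min_{r'\in\Omega}c_1(r',0)\qquad\text{and}\qquad c_2(r,t)\ \le\ \|c_2(\cdot,0)\|_{L^\infty(\Omega)}.$$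
   Context: The flow maps of the two characteristic families are defined by $\partial_t\xi(r_0,t)=c_1(\xi(r_0,t),t)$, $\partial_t\psi(r_0,t)=c_2(\psi(r_0,t),t)$, $\xi(r_0,0)=\psi(r_0,0)=r_0$. For $\Omega=[a,b]$, the domain of influence $D(\Omega,T)$ is the set of all $(r,t)\in\mathbb{R}\times[0,T]$ such that there exist $r_1,r_2\in\Omega$ with $\psi(r_1,t)=\xi(r_2,t)=r$. *)

theory Defs
  imports "HOL-Analysis.Analysis"
begin

definition half_strip :: "real \<Rightarrow> (real \<times> real) set" where
  "half_strip T = {(r, t). 0 < r \<and> 0 \<le> t \<and> t \<le> T}"

definition pd_r :: "(real \<Rightarrow> real \<Rightarrow> real) \<Rightarrow> real \<Rightarrow> real \<Rightarrow> real" where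
  "pd_r f r t = deriv (\<lambda>s. f s t) r"

definition pd_t :: "real \<Rightarrow> (real \<Rightarrow> real \<Rightarrow> real) \<Rightarrow> real \<Rightarrow> real \<Rightarrow> real" where
  "pd_t T f r t = vector_derivative (\<lambda>s. f r s) (at t within {0..T})"

definition C1_strip :: "real \<Rightarrow> (real \<Rightarrow> real \<Rightarrow> real) \<Rightarrow> bool" where
  "C1_strip T f \<longleftrightarrow>
     (\<forall>(r, t) \<in> half_strip T.
        (\<lambda>s. f s t) differentiable (at r) \<and>
        (\<lambda>s. f r s) differentiable (at t within {0..T})) \<and>
     continuous_on (half_strip T) (\<lambda>(r, t). f r t) \<and>
     continuous_on (half_strip T) (\<lambda>(r, t). pd_r f r t) \<and>
     continuous_on (half_strip T) (\<lambda>(r, t). pd_t T f r t)"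

definition pressure :: "real \<Rightarrow> real \<Rightarrow> real \<Rightarrow> real" where
  "pressure K \<gamma> \<rho> = K * \<rho> powr \<gamma>"

definition sound :: "real \<Rightarrow> real \<Rightarrow> real \<Rightarrow> real" where
  "sound K \<gamma> \<rho> = sqrt (K * \<gamma>) * \<rho> powr ((\<gamma> - 1) / 2)"

definition c1 :: "real \<Rightarrow> real \<Rightarrow> (real \<Rightarrow> real \<Rightarrow> real) \<Rightarrow> (real \<Rightarrow> real \<Rightarrow> real) \<Rightarrow> real \<Rightarrow> real \<Rightarrow> real" where
  "c1 K \<gamma> rho u r t = u r t - sound K \<gamma> (rho r t)"

definition c2 :: "real \<Rightarrow> real \<Rightarrow> (real \<Rightarrow> real \<Rightarrow> real) \<Rightarrow> (real \<Rightarrow> real \<Rightarrow> real) \<Rightarrow> real \<Rightarrow> real \<Rightarrow> real" where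
  "c2 K \<gamma> rho u r t = u r t + sound K \<gamma> (rho r t)"

definition radial_euler_solution ::
  "nat \<Rightarrow> real \<Rightarrow> real \<Rightarrow> real \<Rightarrow> (real \<Rightarrow> real \<Rightarrow> real) \<Rightarrow> (real \<Rightarrow> real \<Rightarrow> real) \<Rightarrow> bool" where
  "radial_euler_solution m K \<gamma> T rho u \<longleftrightarrow>
     C1_strip T rho \<and> C1_strip T u \<and>
     (\<forall>(r, t) \<in> half_strip T. 0 < rho r t) \<and>
     (\<forall>(r, t) \<in> half_strip T.
        pd_t T (\<lambda>r t. r ^ m * rho r t) r t + pd_r (\<lambda>r t. r ^ m * rho r t * u r t) r t = 0 \<and>
        pd_t T (\<lambda>r t. r ^ m * rho r t * u r t) r t
          + pd_r (\<lambda>r t. r ^ m * rho r t * (u r t)\<^sup>2) r t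
          + r ^ m * pd_r (\<lambda>r t. pressure K \<gamma> (rho r t)) r t = 0)"

definition is_flow :: "real \<Rightarrow> real \<Rightarrow> real \<Rightarrow> (real \<Rightarrow> real \<Rightarrow> real) \<Rightarrow> (real \<Rightarrow> real \<Rightarrow> real) \<Rightarrow> bool" where
  "is_flow a b T c fl \<longleftrightarrow>
     (\<forall>r0 \<in> {a..b}. fl r0 0 = r0 \<and>
        (\<forall>t \<in> {0..T}. 0 < fl r0 t \<and>
           ((fl r0) has_real_derivative c (fl r0 t) t) (at t within {0..T})))"

definition domain_of_influence ::
  "real \<Rightarrow> real \<Rightarrow> real \<Rightarrow> (real \<Rightarrow> real \<Rightarrow> real) \<Rightarrow> (real \<Rightarrow> real \<Rightarrow> real) \<Rightarrow> (real \<times> real) set" where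
  "domain_of_influence a b T xi psi =
     {(r, t). 0 \<le> t \<and> t \<le> T \<and>
        (\<exists>r1 \<in> {a..b}. \<exists>r2 \<in> {a..b}. psi r1 t = r \<and> xi r2 t = r)}"

end

theory Submission
  imports Defs
begin

text \<open>For \<open>\<gamma> = 3\<close> the sound speed is \<open>h = \<kappa> \<rho>\<close> with \<open>\<kappa> = sqrt (3 K)\<close>, so \<open>c1 = u - \<kappa> \<rho>\<close> and
  \<open>c2 = u + \<kappa> \<rho>\<close> are the Riemann invariants of the planar problem. In the radial
  equations they are no longer conserved: along its own characteristic \<open>c1\<close> changes at rate
  \<open>\<kappa> m \<rho> u / r\<close> and \<open>c2\<close> at rate \<open>- \<kappa> m \<rho> u / r\<close>. If \<open>c1 > 0\<close> initially, a barrier argument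
  keeps \<open>c1 > 0\<close>, hence \<open>u > 0\<close>, so \<open>c1\<close> never decreases along \<open>c1\<close>-characteristics.
  The backward \<open>c2\<close>-characteristic from a point of the domain of influence stays between the
  \<open>c1\<close>-characteristic from \<open>a\<close> and the one through the point; as the \<open>c1\<close>-flow depends
  continuously on its initial point (Gronwall), this region is swept out by \<open>c1\<close>-characteristics,
  so \<open>u \<ge> 0\<close> there and \<open>c2\<close> can only decrease.\<close>

section \<open>Barrier and Gronwall arguments\<close>

lemma DERIV_nonneg_within_imp_le:
  fixes f :: "real \<Rightarrow> real"
  assumes "p \<le> q"
    and deriv: "\<And>s. s \<in> {p..q} \<Longrightarrow> (f has_real_derivative f' s) (at s within {p..q})"
    and nonneg: "\<And>s. s \<in> {p..q} \<Longrightarrow> 0 \<le> f' s"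
  shows "f p \<le> f q"
proof (rule DERIV_nonneg_imp_increasing_open[OF \<open>p \<le> q\<close>])
  fix s assume s: "p < s" "s < q"
  then have "(f has_real_derivative f' s) (at s)"
    using deriv[of s] by (simp add: at_within_Icc_at)
  with nonneg[of s] s show "\<exists>y. DERIV f s :> y \<and> 0 \<le> y" by auto
next
  show "continuous_on {p..q} f"
    using deriv by (rule DERIV_continuous_on)
qed

text \<open>At the last zero before a negative value, \<open>F\<close> would have to become positive to its right.\<close>

lemma nonneg_if_increasing_right_at_zeros:
  fixes F :: "real \<Rightarrow> real"
  assumes cont: "continuous_on {p..q} F" and start: "0 \<le> F p"
    and zeros: "\<And>s. s \<in> {p..<q} \<Longrightarrow> F s = 0 \<Longrightarrow>
      \<exists>d>0. \<forall>h>0. s + h \<in> {p..q} \<longrightarrow> h < d \<longrightarrow> 0 < F (s + h)"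
    and s0: "s0 \<in> {p..q}"
  shows "0 \<le> F s0"
proof (rule ccontr)
  assume "\<not> 0 \<le> F s0"
  then have neg: "F s0 < 0" by simp
  define A where "A = {p..s0} \<inter> F -` {0..}"
  have "closed A"
    unfolding A_def using s0
    by (intro continuous_closed_preimage continuous_on_subset[OF cont]) auto
  moreover have "p \<in> A" and bdd: "bdd_above A"
    using start s0 by (auto simp: A_def bdd_above_def)
  ultimately have "Sup A \<in> A" by (metis closed_contains_Sup empty_iff)
  define s1 where "s1 = Sup A"
  have upper: "x \<le> s1" if "x \<in> A" for x
    unfolding s1_def using that bdd by (rule cSup_upper)
  have s1: "p \<le> s1" "s1 \<le> s0" "0 \<le> F s1"
    using \<open>Sup A \<in> A\<close> by (auto simp: A_def s1_def)
  with neg have "s1 < s0" by (metis order.not_eq_order_implies_strict not_le)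
  have "continuous_on {s1..s0} F"
    using s1 s0 by (intro continuous_on_subset[OF cont]) auto
  then obtain z where z: "s1 \<le> z" "z \<le> s0" "F z = 0"
    using IVT2'[of F s0 0 s1] neg s1 by auto
  then have "z \<in> A" using s1 by (auto simp: A_def)
  with z have "F s1 = 0" using upper[of z] by simp
  then obtain d where d: "0 < d" "\<And>h. 0 < h \<Longrightarrow> s1 + h \<in> {p..q} \<Longrightarrow> h < d \<Longrightarrow> 0 < F (s1 + h)"
    using zeros[of s1] \<open>s1 < s0\<close> s1 s0 by auto
  define h where "h = min (d / 2) ((s0 - s1) / 2)"
  have "h \<le> d / 2" "h \<le> (s0 - s1) / 2"
    unfolding h_def by (rule min.cobounded1, rule min.cobounded2)
  then have h: "0 < h" "h < d" "s1 + h \<le> s0"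
    using d \<open>s1 < s0\<close> by (auto simp: h_def)
  then have "s1 + h \<in> A" using d(2)[of h] s1 s0 by (auto simp: A_def)
  then show False using upper h by fastforce
qed

lemma nonneg_if_DERIV_pos_at_zeros:
  fixes F :: "real \<Rightarrow> real"
  assumes deriv: "\<And>s. s \<in> {p..q} \<Longrightarrow> (F has_real_derivative F' s) (at s within {p..q})"
    and start: "0 \<le> F p"
    and zeros: "\<And>s. s \<in> {p..<q} \<Longrightarrow> F s = 0 \<Longrightarrow> 0 < F' s"
    and s: "s \<in> {p..q}"
  shows "0 \<le> F s"
proof (rule nonneg_if_increasing_right_at_zeros[of p q F s])
  show "continuous_on {p..q} F"
    using deriv by (rule DERIV_continuous_on)
  show "0 \<le> F p" "s \<in> {p..q}" by (fact start s)+
  fix s assume s: "s \<in> {p..<q}" "F s = 0"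
  then have "s \<in> {p..q}" by simp
  from has_real_derivative_pos_inc_right[OF deriv[OF this] zeros[OF s]] s(2)
  show "\<exists>d>0. \<forall>h>0. s + h \<in> {p..q} \<longrightarrow> h < d \<longrightarrow> 0 < F (s + h)" by simp
qed

lemma nonneg_if_DERIV_neg_at_zeros_backward:
  fixes F :: "real \<Rightarrow> real"
  assumes deriv: "\<And>s. s \<in> {p..q} \<Longrightarrow> (F has_real_derivative F' s) (at s within {p..q})"
    and final: "0 \<le> F q"
    and zeros: "\<And>s. s \<in> {p<..q} \<Longrightarrow> F s = 0 \<Longrightarrow> F' s < 0"
    and s: "s \<in> {p..q}"
  shows "0 \<le> F s"
proof -
  have cont: "continuous_on {p..q} F"
    using deriv by (rule DERIV_continuous_on)
  define G where "G s = F (p + q - s)" for s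
  have "0 \<le> G (p + q - s)"
  proof (rule nonneg_if_increasing_right_at_zeros[of p q G])
    show "continuous_on {p..q} G"
      unfolding G_def by (rule continuous_on_compose2[OF cont]) (auto intro: continuous_on_diff)
    show "0 \<le> G p" "p + q - s \<in> {p..q}" using final s by (auto simp: G_def)
    fix s' assume s': "s' \<in> {p..<q}" "G s' = 0"
    then have z: "p + q - s' \<in> {p<..q}" "F (p + q - s') = 0" by (auto simp: G_def)
    then have "p + q - s' \<in> {p..q}" by simp
    from has_real_derivative_neg_dec_left[OF deriv[OF this] zeros[OF z]] z(2)
    obtain d where "0 < d"
      and d: "\<And>h. 0 < h \<Longrightarrow> p + q - s' - h \<in> {p..q} \<Longrightarrow> h < d \<Longrightarrow> 0 < F (p + q - s' - h)"
      by auto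
    show "\<exists>d>0. \<forall>h>0. s' + h \<in> {p..q} \<longrightarrow> h < d \<longrightarrow> 0 < G (s' + h)"
    proof (intro exI[of _ d] conjI allI impI)
      fix h :: real assume "0 < h" "s' + h \<in> {p..q}" "h < d"
      then show "0 < G (s' + h)" using d[of h] by (simp add: G_def algebra_simps)
    qed (fact \<open>0 < d\<close>)
  qed
  then show ?thesis by (simp add: G_def)
qed

lemma exists_first_zero:
  fixes D :: "real \<Rightarrow> real"
  assumes pq: "p \<le> q" and cont: "continuous_on {p..q} D" and "0 < D p" "D q \<le> 0"
  obtains s1 where "s1 \<in> {p..q}" "D s1 = 0" "\<And>s. s \<in> {p..s1} \<Longrightarrow> 0 \<le> D s"
proof -
  define Z where "Z = {p..q} \<inter> D -` {0}"
  have "closed Z" unfolding Z_def by (rule continuous_closed_preimage[OF cont]) auto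
  moreover have "Z \<noteq> {}"
    using IVT2'[of D q 0 p] assms pq by (auto simp: Z_def)
  moreover have bdd: "bdd_below Z" by (auto simp: Z_def bdd_below_def)
  ultimately have "Inf Z \<in> Z" by (metis closed_contains_Inf)
  moreover have "0 \<le> D s" if s: "s \<in> {p..Inf Z}" for s
  proof (rule ccontr)
    assume "\<not> 0 \<le> D s"
    have "Inf Z \<le> q" using \<open>Inf Z \<in> Z\<close> by (simp add: Z_def)
    with s have "continuous_on {p..s} D" by (intro continuous_on_subset[OF cont]) auto
    then obtain z where z: "p \<le> z" "z \<le> s" "D z = 0"
      using IVT2'[of D s 0 p] \<open>\<not> 0 \<le> D s\<close> \<open>0 < D p\<close> s by auto
    moreover have "z \<noteq> s" using z \<open>\<not> 0 \<le> D s\<close> by auto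
    ultimately have "z \<in> Z" "z < Inf Z"
      using s \<open>Inf Z \<le> q\<close> by (auto simp: Z_def)
    then show False using cInf_lower[OF _ bdd, of z] by simp
  qed
  ultimately show ?thesis using that by (auto simp: Z_def)
qed

lemma gronwall_two_sided:
  fixes D :: "real \<Rightarrow> real"
  assumes "0 \<le> p"
    and deriv: "\<And>s. s \<in> {0..p} \<Longrightarrow> (D has_real_derivative D' s) (at s within {0..p})"
    and bound: "\<And>s. s \<in> {0..p} \<Longrightarrow> \<bar>D' s\<bar> \<le> L * D s"
  shows "D 0 \<le> D p * exp (L * p)" and "D p \<le> D 0 * exp (L * p)"
proof -
  have exp_deriv: "((\<lambda>s. exp (\<mu> * s)) has_real_derivative exp (\<mu> * s) * \<mu>) (at s within {0..p})"
    for \<mu> s by (auto intro!: derivative_eq_intros)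
  have "D 0 * exp (L * 0) \<le> D p * exp (L * p)"
  proof (rule DERIV_nonneg_within_imp_le[OF \<open>0 \<le> p\<close>])
    fix s assume s: "s \<in> {0..p}"
    show "((\<lambda>s. D s * exp (L * s)) has_real_derivative (D' s + L * D s) * exp (L * s)) (at s within {0..p})"
      by (rule DERIV_cong[OF DERIV_mult[OF deriv[OF s] exp_deriv]]) (simp add: algebra_simps)
    show "0 \<le> (D' s + L * D s) * exp (L * s)" using bound[OF s] by simp
  qed
  then show "D 0 \<le> D p * exp (L * p)" by simp
  have "- D 0 * exp (- L * 0) \<le> - D p * exp (- L * p)"
  proof (rule DERIV_nonneg_within_imp_le[OF \<open>0 \<le> p\<close>])
    fix s assume s: "s \<in> {0..p}"
    show "((\<lambda>s. - D s * exp (- L * s)) has_real_derivative (L * D s - D' s) * exp (- L * s)) (at s within {0..p})"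
      by (rule DERIV_cong[OF DERIV_mult[OF DERIV_minus[OF deriv[OF s]] exp_deriv]]) (simp add: algebra_simps)
    show "0 \<le> (L * D s - D' s) * exp (- L * s)" using bound[OF s] by simp
  qed
  then have "D p * exp (- L * p) * exp (L * p) \<le> D 0 * exp (L * p)" by simp
  then show "D p \<le> D 0 * exp (L * p)" by (simp add: mult.assoc flip: exp_add)
qed

lemma compact_between_graphs:
  fixes f g :: "real \<Rightarrow> real"
  assumes f: "continuous_on {p..q} f" and g: "continuous_on {p..q} g"
    and le: "\<And>s. s \<in> {p..q} \<Longrightarrow> f s \<le> g s"
  shows "compact {(x, s). s \<in> {p..q} \<and> f s \<le> x \<and> x \<le> g s}"
proof -
  define \<Phi> where "\<Phi> z = (f (fst z) + snd z * (g (fst z) - f (fst z)), fst z)" for z :: "real \<times> real"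
  have "continuous_on ({p..q} \<times> {0..1}) \<Phi>"
    unfolding \<Phi>_def
    by (intro continuous_intros continuous_on_compose2[OF f] continuous_on_compose2[OF g]) auto
  then have "compact (\<Phi> ` ({p..q} \<times> {0..1}))"
    by (intro compact_continuous_image compact_Times compact_Icc)
  moreover have "\<Phi> ` ({p..q} \<times> {0..1}) = {(x, s). s \<in> {p..q} \<and> f s \<le> x \<and> x \<le> g s}"
  proof (intro equalityI subsetI)
    fix z assume "z \<in> \<Phi> ` ({p..q} \<times> {0..1})"
    then obtain s l where "s \<in> {p..q}" "l \<in> {0..1}" "z = \<Phi> (s, l)" by auto
    moreover from this have "0 \<le> l * (g s - f s)" "l * (g s - f s) \<le> g s - f s"
      using le[of s] by (auto simp: mult_left_le_one_le)
    ultimately show "z \<in> {(x, s). s \<in> {p..q} \<and> f s \<le> x \<and> x \<le> g s}" by (auto simp: \<Phi>_def)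
  next
    fix z assume "z \<in> {(x, s). s \<in> {p..q} \<and> f s \<le> x \<and> x \<le> g s}"
    then obtain x s where z: "z = (x, s)" "s \<in> {p..q}" "f s \<le> x" "x \<le> g s" by auto
    define l where "l = (if g s = f s then 0 else (x - f s) / (g s - f s))"
    have "l \<in> {0..1}" "\<Phi> (s, l) = z"
      using z by (auto simp: l_def \<Phi>_def divide_simps)
    with z show "z \<in> \<Phi> ` ({p..q} \<times> {0..1})" by force
  qed
  ultimately show ?thesis by simp
qed

section \<open>Characteristic curves\<close>

definition char_curve :: "real \<Rightarrow> (real \<Rightarrow> real \<Rightarrow> real) \<Rightarrow> (real \<Rightarrow> real) \<Rightarrow> bool" where
  "char_curve T c X \<longleftrightarrow>
     (\<forall>s\<in>{0..T}. 0 < X s \<and> (X has_real_derivative c (X s) s) (at s within {0..T}))"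

lemma is_flow_iff_char_curve:
  "is_flow a b T c fl \<longleftrightarrow> (\<forall>r0\<in>{a..b}. fl r0 0 = r0 \<and> char_curve T c (fl r0))"
  by (auto simp: is_flow_def char_curve_def)

lemma char_curveD:
  assumes "char_curve T c X" and "s \<in> {0..T}"
  shows "0 < X s" and "(X has_real_derivative c (X s) s) (at s within {0..T})"
  using assms by (auto simp: char_curve_def)

lemma char_curve_in_half_strip:
  "char_curve T c X \<Longrightarrow> s \<in> {0..T} \<Longrightarrow> (X s, s) \<in> half_strip T"
  by (auto simp: half_strip_def char_curve_def)

lemma char_curve_continuous_on:
  assumes "char_curve T c X" and "{p..q} \<subseteq> {0..T}"
  shows "continuous_on {p..q} X"
proof -
  have "continuous_on {0..T} X"
    using char_curveD(2)[OF assms(1)] by (rule DERIV_continuous_on)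
  then show ?thesis using assms(2) by (rule continuous_on_subset)
qed

lemma faster_char_curve_stays_ahead:
  assumes X: "char_curve T c X" and Y: "char_curve T c' Y"
    and faster: "\<And>r t. (r, t) \<in> half_strip T \<Longrightarrow> c r t < c' r t"
    and start: "X 0 \<le> Y 0" and s: "s \<in> {0..T}"
  shows "X s \<le> Y s"
proof -
  have "0 \<le> Y s - X s"
  proof (rule nonneg_if_DERIV_pos_at_zeros[where F = "\<lambda>s. Y s - X s"
      and F' = "\<lambda>s. c' (Y s) s - c (X s) s"])
    fix s assume "s \<in> {0..T}"
    then show "((\<lambda>s. Y s - X s) has_real_derivative c' (Y s) s - c (X s) s) (at s within {0..T})"
      by (intro DERIV_diff char_curveD(2)[OF X] char_curveD(2)[OF Y])
  next
    fix s assume "s \<in> {0..<T}" "Y s - X s = 0"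
    then show "0 < c' (Y s) s - c (X s) s"
      using faster[OF char_curve_in_half_strip[OF X]] by simp
  qed (use start s in auto)
  then show ?thesis by simp
qed

lemma faster_char_curve_was_behind:
  assumes X: "char_curve T c X" and Y: "char_curve T c' Y"
    and faster: "\<And>r t. (r, t) \<in> half_strip T \<Longrightarrow> c r t < c' r t"
    and t: "t \<in> {0..T}" and final: "Y t \<le> X t" and s: "s \<in> {0..t}"
  shows "Y s \<le> X s"
proof -
  have "0 \<le> X s - Y s"
  proof (rule nonneg_if_DERIV_neg_at_zeros_backward[where F = "\<lambda>s. X s - Y s"
      and F' = "\<lambda>s. c (X s) s - c' (Y s) s"])
    fix s assume "s \<in> {0..t}"
    with t have "((\<lambda>s. X s - Y s) has_real_derivative c (X s) s - c' (Y s) s) (at s within {0..T})"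
      by (intro DERIV_diff char_curveD(2)[OF X] char_curveD(2)[OF Y]) auto
    then show "((\<lambda>s. X s - Y s) has_real_derivative c (X s) s - c' (Y s) s) (at s within {0..t})"
      by (rule DERIV_subset) (use t in auto)
  next
    fix s assume s: "s \<in> {0<..t}" "X s - Y s = 0"
    then have "s \<in> {0..T}" using t by auto
    from faster[OF char_curve_in_half_strip[OF X this]] s(2)
    show "c (X s) s - c' (Y s) s < 0" by simp
  qed (use final s in auto)
  then show ?thesis by simp
qed

locale speed_field =
  fixes T :: real and c c_r :: "real \<Rightarrow> real \<Rightarrow> real"
  assumes has_deriv_r: "(r, t) \<in> half_strip T \<Longrightarrow> ((\<lambda>x. c x t) has_real_derivative c_r r t) (at r)"
    and continuous_deriv_r: "continuous_on (half_strip T) (\<lambda>(r, t). c_r r t)"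
begin

lemma lipschitz_between_curves:
  assumes X1: "continuous_on {0..p} X1" and X2: "continuous_on {0..p} X2" and "p \<le> T"
    and between: "\<And>s. s \<in> {0..p} \<Longrightarrow> 0 < X1 s \<and> X1 s \<le> X2 s"
  obtains L where "\<And>s x y. s \<in> {0..p} \<Longrightarrow> x \<in> {X1 s..X2 s} \<Longrightarrow> y \<in> {X1 s..X2 s} \<Longrightarrow>
    \<bar>c y s - c x s\<bar> \<le> L * \<bar>y - x\<bar>"
proof -
  define R where "R = {(x, s). s \<in> {0..p} \<and> X1 s \<le> x \<and> x \<le> X2 s}"
  have "compact R"
    unfolding R_def using between by (intro compact_between_graphs X1 X2) auto
  moreover have "R \<subseteq> half_strip T"
    using between \<open>p \<le> T\<close> by (fastforce simp: R_def half_strip_def)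
  ultimately have "compact ((\<lambda>(r, t). c_r r t) ` R)"
    by (intro compact_continuous_image continuous_on_subset[OF continuous_deriv_r])
  then obtain L where L: "\<And>z. z \<in> R \<Longrightarrow> \<bar>(\<lambda>(r, t). c_r r t) z\<bar> \<le> L"
    by (metis compact_imp_bounded bounded_iff image_eqI real_norm_def)
  show thesis
  proof (rule that)
    fix s x y assume s: "s \<in> {0..p}" and xy: "x \<in> {X1 s..X2 s}" "y \<in> {X1 s..X2 s}"
    have "norm (c y s - c x s) \<le> L * norm (y - x)"
    proof (rule field_differentiable_bound[OF convex_real_interval(5)])
      fix z assume z: "z \<in> {X1 s..X2 s}"
      then have "(z, s) \<in> R" using s by (simp add: R_def)
      then show "((\<lambda>x. c x s) has_field_derivative c_r z s) (at z within {X1 s..X2 s})"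
        using has_deriv_r \<open>R \<subseteq> half_strip T\<close> by (blast intro: has_field_derivative_at_within)
      show "norm (c_r z s) \<le> L" using L[OF \<open>(z, s) \<in> R\<close>] by simp
    qed (fact xy)+
    then show "\<bar>c y s - c x s\<bar> \<le> L * \<bar>y - x\<bar>" by simp
  qed
qed

lemma gronwall_between_char_curves:
  assumes Z1: "char_curve T c Z1" and Z2: "char_curve T c Z2" and p: "p \<in> {0..T}"
    and ordered: "\<And>s. s \<in> {0..p} \<Longrightarrow> Z1 s \<le> Z2 s"
  obtains L where "\<And>X1 X2. char_curve T c X1 \<Longrightarrow> char_curve T c X2 \<Longrightarrow>
    (\<And>s. s \<in> {0..p} \<Longrightarrow> Z1 s \<le> X1 s \<and> X1 s \<le> X2 s \<and> X2 s \<le> Z2 s) \<Longrightarrow>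
    X2 0 - X1 0 \<le> (X2 p - X1 p) * exp (L * p) \<and> X2 p - X1 p \<le> (X2 0 - X1 0) * exp (L * p)"
proof -
  have sub: "{0..p} \<subseteq> {0..T}" using p by auto
  obtain L where L: "\<And>s x y. s \<in> {0..p} \<Longrightarrow> x \<in> {Z1 s..Z2 s} \<Longrightarrow> y \<in> {Z1 s..Z2 s} \<Longrightarrow>
    \<bar>c y s - c x s\<bar> \<le> L * \<bar>y - x\<bar>"
  proof (rule lipschitz_between_curves)
    show "continuous_on {0..p} Z1" "continuous_on {0..p} Z2"
      using sub by (auto intro: char_curve_continuous_on[OF Z1] char_curve_continuous_on[OF Z2])
    show "p \<le> T" using p by simp
    show "0 < Z1 s \<and> Z1 s \<le> Z2 s" if "s \<in> {0..p}" for s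
      using char_curveD(1)[OF Z1] ordered[OF that] that sub by auto
  qed blast
  show thesis
  proof (rule that)
    fix X1 X2 assume X1: "char_curve T c X1" and X2: "char_curve T c X2"
      and between: "\<And>s. s \<in> {0..p} \<Longrightarrow> Z1 s \<le> X1 s \<and> X1 s \<le> X2 s \<and> X2 s \<le> Z2 s"
    define D where "D s = X2 s - X1 s" for s
    have deriv: "(D has_real_derivative c (X2 s) s - c (X1 s) s) (at s within {0..p})"
      if s: "s \<in> {0..p}" for s
    proof -
      have "(D has_real_derivative c (X2 s) s - c (X1 s) s) (at s within {0..T})"
        unfolding D_def using s sub by (intro DERIV_diff char_curveD(2)[OF X2] char_curveD(2)[OF X1]) auto
      then show ?thesis using sub by (rule DERIV_subset)
    qed
    have bound: "\<bar>c (X2 s) s - c (X1 s) s\<bar> \<le> L * D s" if s: "s \<in> {0..p}" for s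
      using L[OF s, of "X1 s" "X2 s"] between[OF s] by (simp add: D_def)
    from gronwall_two_sided[OF _ deriv bound] p
    show "X2 0 - X1 0 \<le> (X2 p - X1 p) * exp (L * p) \<and> X2 p - X1 p \<le> (X2 0 - X1 0) * exp (L * p)"
      by (simp add: D_def)
  qed
qed

text \<open>Uniqueness for the characteristic ODE: by Gronwall, two characteristics that meet
  must have started at the same point.\<close>

lemma char_curves_strict_order:
  assumes X1: "char_curve T c X1" and X2: "char_curve T c X2"
    and start: "X1 0 < X2 0" and s: "s \<in> {0..T}"
  shows "X1 s < X2 s"
proof (rule ccontr)
  assume "\<not> X1 s < X2 s"
  have "continuous_on {0..s} (\<lambda>s. X2 s - X1 s)"
    using s by (intro continuous_on_diff char_curve_continuous_on[OF X1] char_curve_continuous_on[OF X2]) auto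
  then obtain s1 where s1: "s1 \<in> {0..s}" "X2 s1 - X1 s1 = 0"
    and ordered: "\<And>s'. s' \<in> {0..s1} \<Longrightarrow> X1 s' \<le> X2 s'"
    using exists_first_zero[of 0 s "\<lambda>s. X2 s - X1 s"] s start \<open>\<not> X1 s < X2 s\<close> by auto
  have "s1 \<in> {0..T}" using s1 s by auto
  obtain L where L: "\<And>Y1 Y2. char_curve T c Y1 \<Longrightarrow> char_curve T c Y2 \<Longrightarrow>
    (\<And>s. s \<in> {0..s1} \<Longrightarrow> X1 s \<le> Y1 s \<and> Y1 s \<le> Y2 s \<and> Y2 s \<le> X2 s) \<Longrightarrow>
    Y2 0 - Y1 0 \<le> (Y2 s1 - Y1 s1) * exp (L * s1) \<and> Y2 s1 - Y1 s1 \<le> (Y2 0 - Y1 0) * exp (L * s1)"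
    by (rule gronwall_between_char_curves[OF X1 X2 \<open>s1 \<in> {0..T}\<close> ordered]) (assumption, erule that)
  have "X2 0 - X1 0 \<le> (X2 s1 - X1 s1) * exp (L * s1)"
    using L[OF X1 X2] ordered by simp
  then show False using s1 start by simp
qed

lemma flow_mono:
  assumes fl: "is_flow a b T c fl" and r: "r \<in> {a..b}" "r' \<in> {a..b}" "r \<le> r'"
    and s: "s \<in> {0..T}"
  shows "fl r s \<le> fl r' s"
proof (cases "r = r'")
  case False
  with r fl show ?thesis
    using char_curves_strict_order[of "fl r" "fl r'" s] s
    by (force simp: is_flow_iff_char_curve)
qed simp

lemma flow_continuous_on:
  assumes fl: "is_flow a b T c fl" and s: "s \<in> {0..T}"
  shows "continuous_on {a..b} (\<lambda>r0. fl r0 s)"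
proof (cases "a \<le> b")
  case True
  have char: "\<And>r0. r0 \<in> {a..b} \<Longrightarrow> char_curve T c (fl r0)"
    and init: "\<And>r0. r0 \<in> {a..b} \<Longrightarrow> fl r0 0 = r0"
    using fl by (auto simp: is_flow_iff_char_curve)
  have ab: "a \<in> {a..b}" "b \<in> {a..b}" using True by auto
  have mono: "fl r s' \<le> fl r' s'" if "r \<in> {a..b}" "r' \<in> {a..b}" "r \<le> r'" "s' \<in> {0..s}" for r r' s'
    using flow_mono[OF fl that(1-3)] that(4) s by simp
  obtain L where L: "\<And>X1 X2. char_curve T c X1 \<Longrightarrow> char_curve T c X2 \<Longrightarrow>
    (\<And>s'. s' \<in> {0..s} \<Longrightarrow> fl a s' \<le> X1 s' \<and> X1 s' \<le> X2 s' \<and> X2 s' \<le> fl b s') \<Longrightarrow>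
    X2 0 - X1 0 \<le> (X2 s - X1 s) * exp (L * s) \<and> X2 s - X1 s \<le> (X2 0 - X1 0) * exp (L * s)"
    by (rule gronwall_between_char_curves[OF char[OF ab(1)] char[OF ab(2)] s mono[OF ab True]])
      (assumption, erule that)
  define C where "C = exp (L * s)"
  have step: "dist (fl r s) (fl r' s) \<le> C * dist r r'"
    if r: "r \<in> {a..b}" "r' \<in> {a..b}" "r \<le> r'" for r r'
  proof -
    have "fl a s' \<le> fl r s' \<and> fl r s' \<le> fl r' s' \<and> fl r' s' \<le> fl b s'"
      if "s' \<in> {0..s}" for s'
      using mono[OF ab(1) r(1)] mono[OF r] mono[OF r(2) ab(2)] r that by simp
    then have "fl r' s - fl r s \<le> (fl r' 0 - fl r 0) * C"
      using L[OF char[OF r(1)] char[OF r(2)]] by (simp add: C_def)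
    moreover have "fl r s \<le> fl r' s" using mono[OF r, of s] s by simp
    ultimately show ?thesis using init r by (simp add: dist_real_def mult.commute)
  qed
  have "C-lipschitz_on {a..b} (\<lambda>r0. fl r0 s)"
  proof (rule lipschitz_onI)
    fix x y assume xy: "x \<in> {a..b}" "y \<in> {a..b}"
    show "dist (fl x s) (fl y s) \<le> C * dist x y"
      using step[OF xy] step[OF xy(2,1)] by (cases "x \<le> y") (simp_all add: dist_commute)
  qed (simp add: C_def)
  then show ?thesis by (rule lipschitz_on_continuous_on)
qed simp

lemma flow_attains_between:
  assumes fl: "is_flow a b T c fl" and s: "s \<in> {0..T}" and r2: "r2 \<in> {a..b}"
    and x: "fl a s \<le> x" "x \<le> fl r2 s"
  obtains r0 where "r0 \<in> {a..r2}" and "fl r0 s = x"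
proof -
  have "continuous_on {a..r2} (\<lambda>r0. fl r0 s)"
    by (rule continuous_on_subset[OF flow_continuous_on[OF fl s]]) (use r2 in auto)
  then show ?thesis
    using IVT'[of "\<lambda>r0. fl r0 s" a x r2] x r2 that by auto
qed

end

section \<open>The radial Euler equations for \<open>\<gamma> = 3\<close>\<close>

lemma C1_strip_has_deriv_r:
  assumes "C1_strip T f" and "(r, t) \<in> half_strip T"
  shows "((\<lambda>x. f x t) has_real_derivative pd_r f r t) (at r)"
  using assms unfolding C1_strip_def pd_r_def
  by (auto simp only: DERIV_deriv_iff_real_differentiable)

lemma C1_strip_has_deriv_t:
  assumes "C1_strip T f" and "(r, t) \<in> half_strip T"
  shows "((\<lambda>s. f r s) has_real_derivative pd_t T f r t) (at t within {0..T})"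
  using assms unfolding C1_strip_def pd_t_def has_real_derivative_iff_has_vector_derivative
  by (auto intro: vector_derivative_works[THEN iffD1])

lemma C1_strip_continuous_on:
  assumes "C1_strip T f"
  shows "continuous_on (half_strip T) (\<lambda>(r, t). f r t)"
    and "continuous_on (half_strip T) (\<lambda>(r, t). pd_r f r t)"
    and "continuous_on (half_strip T) (\<lambda>(r, t). pd_t T f r t)"
  using assms by (simp_all add: C1_strip_def)

lemma pd_r_eqI:
  "((\<lambda>x. f x t) has_real_derivative D) (at r) \<Longrightarrow> pd_r f r t = D"
  unfolding pd_r_def by (rule DERIV_imp_deriv)

lemma pd_t_eqI:
  assumes "0 < T" and "t \<in> {0..T}" and "((\<lambda>s. f r s) has_real_derivative D) (at t within {0..T})"
  shows "pd_t T f r t = D"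
proof -
  have "at t within {0..T} \<noteq> bot"
    using assms(1,2) by (simp add: trivial_limit_within)
  then show ?thesis
    unfolding pd_t_def using assms(3)
    by (simp add: vector_derivative_within has_real_derivative_iff_has_vector_derivative)
qed

text \<open>Continuity of the time derivative turns the two partial derivatives into a total one.\<close>

lemma C1_strip_has_deriv_along_curve:
  assumes f: "C1_strip T f" and s: "s \<in> {0..T}"
    and X: "(X has_real_derivative X') (at s within {0..T})" and pos: "0 < X s"
  shows "((\<lambda>s. f (X s) s) has_real_derivative pd_r f (X s) s * X' + pd_t T f (X s) s)
    (at s within {0..T})"
proof -
  have strip: "half_strip T = {0<..} \<times> {0..T}" by (auto simp: half_strip_def)
  have inS: "(X s, s) \<in> {0<..} \<times> {0..T}" using s pos by simp
  have fr: "((\<lambda>r. f r s) has_derivative (\<lambda>h. pd_r f (X s) s * h)) (at (X s) within {0<..})"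
    using C1_strip_has_deriv_r[OF f] inS strip
    by (simp add: has_field_derivative_def has_derivative_at_withinI)
  have ft: "((\<lambda>t. f x t) has_derivative blinfun_apply (blinfun_scaleR_left (pd_t T f x t)))
      (at t within {0..T})" if "x \<in> {0<..}" "t \<in> {0..T}" for x t
    using C1_strip_has_deriv_t[OF f, of x t] that strip
    by (simp add: has_field_derivative_def mult.commute[of _ "pd_t T f x t"])
  have "continuous (at (X s, s) within {0<..} \<times> {0..T}) (\<lambda>(r, t). pd_t T f r t)"
    using C1_strip_continuous_on(3)[OF f] inS strip by (simp add: continuous_on_eq_continuous_within)
  then have ft_cont: "continuous (at (X s, s) within {0<..} \<times> {0..T})
      (\<lambda>(r, t). blinfun_scaleR_left (pd_t T f r t))"
    using bounded_linear.continuous[OF bounded_linear_blinfun_scaleR_left] by (simp add: case_prod_unfold)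
  have "((\<lambda>(r, t). f r t) has_derivative
      (\<lambda>(dr, dt). pd_r f (X s) s * dr + blinfun_scaleR_left (pd_t T f (X s) s) dt))
      (at (X s, s) within {0<..} \<times> {0..T})"
    by (rule has_derivative_partialsI[OF fr ft ft_cont]) (use s in auto)
  moreover have "at (X s, s) within {0<..} \<times> {0..T} = at (X s, s) within UNIV \<times> {0..T}"
    by (rule at_within_nhd[where S = "{0<..} \<times> UNIV"]) (use pos in \<open>auto intro: open_Times\<close>)
  ultimately have "((\<lambda>(r, t). f r t) has_derivative
      (\<lambda>(dr, dt). pd_r f (X s) s * dr + blinfun_scaleR_left (pd_t T f (X s) s) dt))
      (at (X s, s) within (\<lambda>s. (X s, s)) ` {0..T})"
    by (auto elim: has_derivative_subset)
  moreover have "((\<lambda>s. (X s, s)) has_derivative (\<lambda>h. (h * X', h))) (at s within {0..T})"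
    using X unfolding has_field_derivative_def by (auto intro!: derivative_eq_intros)
  ultimately have "((\<lambda>s. f (X s) s) has_derivative
      (\<lambda>h. pd_r f (X s) s * (h * X') + h * pd_t T f (X s) s)) (at s within {0..T})"
    using has_derivative_in_compose by (fastforce simp: o_def)
  then show ?thesis
    unfolding has_field_derivative_def by (rule has_derivative_eq_rhs) (auto simp: algebra_simps)
qed

locale radial_euler_gamma3 =
  fixes m :: nat and K T :: real and rho u :: "real \<Rightarrow> real \<Rightarrow> real"
  assumes T_pos: "0 < T" and K_pos: "0 < K" and m_pos: "1 \<le> m"
    and solution: "radial_euler_solution m K 3 T rho u"
begin

abbreviation \<kappa> :: real where "\<kappa> \<equiv> sqrt (K * 3)"

lemma C1_rho: "C1_strip T rho" and C1_u: "C1_strip T u"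
  using solution by (simp_all add: radial_euler_solution_def)

lemma rho_pos: "(r, t) \<in> half_strip T \<Longrightarrow> 0 < rho r t"
  using solution by (auto simp: radial_euler_solution_def)

lemma sound_eq: "(r, t) \<in> half_strip T \<Longrightarrow> sound K 3 (rho r t) = \<kappa> * rho r t"
  using rho_pos[of r t] by (simp add: sound_def)

lemma c1_eq: "(r, t) \<in> half_strip T \<Longrightarrow> c1 K 3 rho u r t = u r t - \<kappa> * rho r t"
  and c2_eq: "(r, t) \<in> half_strip T \<Longrightarrow> c2 K 3 rho u r t = u r t + \<kappa> * rho r t"
  by (simp_all add: c1_def c2_def sound_eq)

lemma c1_less_c2: "(r, t) \<in> half_strip T \<Longrightarrow> c1 K 3 rho u r t < c2 K 3 rho u r t"
  using rho_pos[of r t] K_pos by (simp add: c1_eq c2_eq)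

lemma power_m_eq: "r ^ m = r * r ^ (m - 1)"
  using m_pos by (simp add: power_eq_if)

lemma mass_nonconservative:
  assumes rt: "(r, t) \<in> half_strip T"
  shows "pd_t T rho r t + u r t * pd_r rho r t + rho r t * pd_r u r t + real m * rho r t * u r t / r = 0"
proof -
  have r: "0 < r" and t: "t \<in> {0..T}" using rt by (auto simp: half_strip_def)
  note \<rho>_r = C1_strip_has_deriv_r[OF C1_rho rt] and u_r = C1_strip_has_deriv_r[OF C1_u rt]
  have "pd_t T (\<lambda>r t. r ^ m * rho r t) r t = r ^ m * pd_t T rho r t"
    by (rule pd_t_eqI[OF T_pos t]) (auto intro!: derivative_eq_intros C1_strip_has_deriv_t[OF C1_rho rt])
  moreover have "pd_r (\<lambda>r t. r ^ m * rho r t * u r t) r t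
      = real m * r ^ (m - 1) * rho r t * u r t + r ^ m * (pd_r rho r t * u r t + rho r t * pd_r u r t)"
    by (rule pd_r_eqI) (auto intro!: derivative_eq_intros \<rho>_r u_r simp: algebra_simps)
  ultimately have "r ^ (m - 1) * r * (pd_t T rho r t + u r t * pd_r rho r t + rho r t * pd_r u r t
      + real m * rho r t * u r t / r)
    = pd_t T (\<lambda>r t. r ^ m * rho r t) r t + pd_r (\<lambda>r t. r ^ m * rho r t * u r t) r t"
    using r by (simp add: power_m_eq[of r] field_simps)
  also have "\<dots> = 0" using solution rt by (auto simp: radial_euler_solution_def)
  finally show ?thesis using r by simp
qed

lemma momentum_nonconservative:
  assumes rt: "(r, t) \<in> half_strip T"
  shows "pd_t T u r t + u r t * pd_r u r t + 3 * K * rho r t * pd_r rho r t = 0"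
proof -
  have r: "0 < r" and t: "t \<in> {0..T}" using rt by (auto simp: half_strip_def)
  note \<rho>_r = C1_strip_has_deriv_r[OF C1_rho rt] and u_r = C1_strip_has_deriv_r[OF C1_u rt]
  define mass where "mass = pd_t T rho r t + u r t * pd_r rho r t + rho r t * pd_r u r t
    + real m * rho r t * u r t / r"
  have "mass = 0" unfolding mass_def by (rule mass_nonconservative[OF rt])
  have "pd_t T (\<lambda>r t. r ^ m * rho r t * u r t) r t
      = r ^ m * (pd_t T rho r t * u r t + rho r t * pd_t T u r t)"
    by (rule pd_t_eqI[OF T_pos t])
      (auto intro!: derivative_eq_intros C1_strip_has_deriv_t[OF C1_rho rt]
        C1_strip_has_deriv_t[OF C1_u rt] simp: algebra_simps)
  moreover have "pd_r (\<lambda>r t. r ^ m * rho r t * (u r t)\<^sup>2) r t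
      = real m * r ^ (m - 1) * rho r t * (u r t)\<^sup>2
        + r ^ m * (pd_r rho r t * (u r t)\<^sup>2 + rho r t * (2 * u r t * pd_r u r t))"
    by (rule pd_r_eqI) (auto intro!: derivative_eq_intros \<rho>_r u_r simp: algebra_simps power2_eq_square)
  moreover have "pd_r (\<lambda>r t. pressure K 3 (rho r t)) r t = 3 * K * (rho r t)\<^sup>2 * pd_r rho r t"
    unfolding pressure_def
    by (rule pd_r_eqI, rule DERIV_cong[OF DERIV_cmult[OF DERIV_fun_powr[OF \<rho>_r rho_pos[OF rt]]]])
      (use rho_pos[OF rt] in simp)
  ultimately have "r ^ (m - 1) * r * (rho r t * (pd_t T u r t + u r t * pd_r u r t
      + 3 * K * rho r t * pd_r rho r t) + u r t * mass)
    = pd_t T (\<lambda>r t. r ^ m * rho r t * u r t) r t + pd_r (\<lambda>r t. r ^ m * rho r t * (u r t)\<^sup>2) r t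
      + r ^ m * pd_r (\<lambda>r t. pressure K 3 (rho r t)) r t"
    unfolding mass_def using r by (simp add: power_m_eq[of r] field_simps power2_eq_square)
  also have "\<dots> = 0" using solution rt by (auto simp: radial_euler_solution_def)
  finally show ?thesis using r rho_pos[OF rt] \<open>mass = 0\<close> by simp
qed

sublocale c1_speed: speed_field T "c1 K 3 rho u" "\<lambda>r t. pd_r u r t - \<kappa> * pd_r rho r t"
proof
  fix r t assume rt: "(r, t) \<in> half_strip T"
  have "((\<lambda>x. u x t - \<kappa> * rho x t) has_real_derivative pd_r u r t - \<kappa> * pd_r rho r t) (at r)"
    by (intro DERIV_diff DERIV_cmult C1_strip_has_deriv_r[OF C1_u rt] C1_strip_has_deriv_r[OF C1_rho rt])
  then show "((\<lambda>x. c1 K 3 rho u x t) has_real_derivative pd_r u r t - \<kappa> * pd_r rho r t) (at r)"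
    by (rule has_field_derivative_transform_within_open[where S = "{0<..}"])
      (use rt in \<open>auto simp: c1_eq half_strip_def\<close>)
next
  show "continuous_on (half_strip T) (\<lambda>(r, t). pd_r u r t - \<kappa> * pd_r rho r t)"
    using C1_strip_continuous_on(2)[OF C1_u] C1_strip_continuous_on(2)[OF C1_rho]
    unfolding case_prod_unfold by (intro continuous_on_diff continuous_on_mult_left)
qed

lemma riemann_invariant_has_deriv_along_char:
  assumes s: "s \<in> {0..T}" and pos: "0 < X s" and \<sigma>: "\<sigma> = 1 \<or> \<sigma> = -1"
    and X: "(X has_real_derivative u (X s) s + \<sigma> * \<kappa> * rho (X s) s) (at s within {0..T})"
  shows "((\<lambda>s. u (X s) s + \<sigma> * \<kappa> * rho (X s) s) has_real_derivative
      - \<sigma> * \<kappa> * real m * rho (X s) s * u (X s) s / X s) (at s within {0..T})"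
proof -
  have rt: "(X s, s) \<in> half_strip T" using s pos by (simp add: half_strip_def)
  define V where "V = u (X s) s + \<sigma> * \<kappa> * rho (X s) s"
  have deriv: "((\<lambda>s. u (X s) s + \<sigma> * \<kappa> * rho (X s) s) has_real_derivative
      (pd_r u (X s) s * V + pd_t T u (X s) s) + \<sigma> * \<kappa> * (pd_r rho (X s) s * V + pd_t T rho (X s) s))
      (at s within {0..T})"
    using C1_strip_has_deriv_along_curve[OF C1_u s X pos]
      C1_strip_has_deriv_along_curve[OF C1_rho s X pos]
    unfolding V_def by (intro DERIV_add DERIV_cmult) (auto simp: mult.assoc)
  have "\<sigma> * \<sigma> = 1" "\<kappa> * \<kappa> = 3 * K" using \<sigma> K_pos by auto
  then have "(pd_r u (X s) s * V + pd_t T u (X s) s) + \<sigma> * \<kappa> * (pd_r rho (X s) s * V + pd_t T rho (X s) s)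
      + \<sigma> * \<kappa> * real m * rho (X s) s * u (X s) s / X s
      = (pd_t T u (X s) s + u (X s) s * pd_r u (X s) s + 3 * K * rho (X s) s * pd_r rho (X s) s)
        + \<sigma> * \<kappa> * (pd_t T rho (X s) s + u (X s) s * pd_r rho (X s) s
          + rho (X s) s * pd_r u (X s) s + real m * rho (X s) s * u (X s) s / X s)"
    unfolding V_def using pos by (simp add: field_simps)
  also have "\<dots> = 0" using mass_nonconservative[OF rt] momentum_nonconservative[OF rt] by simp
  finally show ?thesis by (intro DERIV_cong[OF deriv]) linarith
qed

lemma c1_ge_initial_along_c1_char:
  assumes X: "char_curve T (c1 K 3 rho u) X" and start: "0 < c1 K 3 rho u (X 0) 0"
    and s: "s \<in> {0..T}"
  shows "c1 K 3 rho u (X 0) 0 \<le> c1 K 3 rho u (X s) s"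
proof -
  define g where "g s = u (X s) s - \<kappa> * rho (X s) s" for s
  have c1_g: "c1 K 3 rho u (X s) s = g s" if "s \<in> {0..T}" for s
    using c1_eq[OF char_curve_in_half_strip[OF X that]] by (simp add: g_def)
  have g_deriv: "(g has_real_derivative \<kappa> * real m * rho (X s) s * u (X s) s / X s)
      (at s within {0..T})" if "s \<in> {0..T}" for s
    using riemann_invariant_has_deriv_along_char[where X = X and \<sigma> = "-1",
        OF that char_curveD(1)[OF X that]]
      char_curveD(2)[OF X that] c1_g[OF that]
    by (simp add: g_def[abs_def])
  have "0 \<le> g s - g 0"
  proof (rule nonneg_if_DERIV_pos_at_zeros[where F = "\<lambda>s. g s - g 0"])
    fix s assume "s \<in> {0..T}"
    from DERIV_diff[OF g_deriv[OF this] DERIV_const]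
    show "((\<lambda>s. g s - g 0) has_real_derivative \<kappa> * real m * rho (X s) s * u (X s) s / X s)
        (at s within {0..T})" by simp
  next
    fix s assume "s \<in> {0..<T}" and "g s - g 0 = 0"
    then have sT: "s \<in> {0..T}" and "0 < g s" using start c1_g[of 0] T_pos by auto
    have "0 < rho (X s) s" "0 < X s"
      using rho_pos[OF char_curve_in_half_strip[OF X sT]] char_curveD(1)[OF X sT] by auto
    moreover from this have "0 < \<kappa> * rho (X s) s" using K_pos by simp
    then have "0 < u (X s) s" using \<open>0 < g s\<close> unfolding g_def by linarith
    ultimately show "0 < \<kappa> * real m * rho (X s) s * u (X s) s / X s"
      using K_pos m_pos by simp
  qed (use s in auto)
  then show ?thesis using c1_g[of 0] c1_g[OF s] s by simp
qed

lemma c2_le_initial_along_c2_char: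
  assumes Y: "char_curve T (c2 K 3 rho u) Y" and t: "t \<in> {0..T}"
    and u_nonneg: "\<And>s. s \<in> {0..t} \<Longrightarrow> 0 \<le> u (Y s) s"
  shows "c2 K 3 rho u (Y t) t \<le> c2 K 3 rho u (Y 0) 0"
proof -
  define g where "g s = u (Y s) s + \<kappa> * rho (Y s) s" for s
  have "- g 0 \<le> - g t"
  proof (rule DERIV_nonneg_within_imp_le[where f = "\<lambda>s. - g s"
      and f' = "\<lambda>s. \<kappa> * real m * rho (Y s) s * u (Y s) s / Y s"])
    fix s assume s: "s \<in> {0..t}"
    then have sT: "s \<in> {0..T}" using t by simp
    have "(Y has_real_derivative u (Y s) s + 1 * \<kappa> * rho (Y s) s) (at s within {0..T})"
      using char_curveD(2)[OF Y sT] c2_eq[OF char_curve_in_half_strip[OF Y sT]] by simp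
    from riemann_invariant_has_deriv_along_char[where X = Y, OF sT char_curveD(1)[OF Y sT] _ this]
    have "((\<lambda>s. - g s) has_real_derivative \<kappa> * real m * rho (Y s) s * u (Y s) s / Y s)
        (at s within {0..T})"
      unfolding g_def using DERIV_minus by fastforce
    then show "((\<lambda>s. - g s) has_real_derivative \<kappa> * real m * rho (Y s) s * u (Y s) s / Y s)
        (at s within {0..t})"
      by (rule DERIV_subset) (use t in auto)
    show "0 \<le> \<kappa> * real m * rho (Y s) s * u (Y s) s / Y s"
      using rho_pos[OF char_curve_in_half_strip[OF Y sT]] char_curveD(1)[OF Y sT] u_nonneg[OF s] K_pos
      by (intro divide_nonneg_pos mult_nonneg_nonneg) auto
  qed (use t in simp)
  then show ?thesis
    using c2_eq[OF char_curve_in_half_strip[OF Y t]] c2_eq[OF char_curve_in_half_strip[OF Y, of 0]] t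
    by (simp add: g_def)
qed

lemma u_pos_in_c1_flow_region:
  assumes xi: "is_flow a b T (c1 K 3 rho u) xi"
    and c1_pos: "\<forall>r \<in> {a..b}. 0 < c1 K 3 rho u r 0"
    and s: "s \<in> {0..T}" and r2: "r2 \<in> {a..b}" and x: "xi a s \<le> x" "x \<le> xi r2 s"
  shows "0 < u x s"
proof -
  obtain r0 where r0: "r0 \<in> {a..r2}" and "xi r0 s = x"
    using c1_speed.flow_attains_between[OF xi s r2 x] .
  then have "r0 \<in> {a..b}" using r2 by simp
  then have "char_curve T (c1 K 3 rho u) (xi r0)" and "xi r0 0 = r0"
    using xi by (auto simp: is_flow_iff_char_curve)
  then have "0 < c1 K 3 rho u x s"
    using c1_ge_initial_along_c1_char[of "xi r0" s] c1_pos \<open>r0 \<in> {a..b}\<close> s \<open>xi r0 s = x\<close>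
    by fastforce
  moreover have xs: "(x, s) \<in> half_strip T"
    using char_curve_in_half_strip[OF \<open>char_curve T _ (xi r0)\<close> s] \<open>xi r0 s = x\<close> by simp
  ultimately have "\<kappa> * rho x s < u x s" by (simp add: c1_eq)
  moreover have "0 < \<kappa> * rho x s" using rho_pos[OF xs] K_pos by simp
  ultimately show ?thesis by linarith
qed

lemma c2_le_initial_on_domain:
  assumes xi: "is_flow a b T (c1 K 3 rho u) xi" and psi: "is_flow a b T (c2 K 3 rho u) psi"
    and c1_pos: "\<forall>r \<in> {a..b}. 0 < c1 K 3 rho u r 0"
    and r1: "r1 \<in> {a..b}" and r2: "r2 \<in> {a..b}" and t: "t \<in> {0..T}"
    and meet: "psi r1 t = xi r2 t"
  shows "c2 K 3 rho u (psi r1 t) t \<le> c2 K 3 rho u r1 0"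
proof -
  have "a \<in> {a..b}" using r1 by simp
  then have xi_a: "char_curve T (c1 K 3 rho u) (xi a)" "xi a 0 = a"
    and xi_r2: "char_curve T (c1 K 3 rho u) (xi r2)"
    and psi_r1: "char_curve T (c2 K 3 rho u) (psi r1)" "psi r1 0 = r1"
    using xi psi r1 r2 by (auto simp: is_flow_iff_char_curve)
  have "0 \<le> u (psi r1 s) s" if s: "s \<in> {0..t}" for s
  proof -
    have sT: "s \<in> {0..T}" using s t by simp
    have "xi a s \<le> psi r1 s"
      using faster_char_curve_stays_ahead[OF xi_a(1) psi_r1(1) c1_less_c2 _ sT] xi_a(2) psi_r1(2) r1
      by simp
    moreover have "psi r1 s \<le> xi r2 s"
      using faster_char_curve_was_behind[OF xi_r2 psi_r1(1) c1_less_c2 t _ s] meet by simp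
    ultimately show ?thesis
      using u_pos_in_c1_flow_region[OF xi c1_pos sT r2] by (simp add: less_imp_le)
  qed
  then show ?thesis
    using c2_le_initial_along_c2_char[OF psi_r1(1) t] psi_r1(2) by simp
qed

lemma bdd_above_abs_c2_initial:
  assumes "0 < a"
  shows "bdd_above ((\<lambda>r. \<bar>c2 K 3 rho u r 0\<bar>) ` {a..b})"
proof -
  have strip: "(r, 0) \<in> half_strip T" if "r \<in> {a..b}" for r
    using that assms T_pos by (auto simp: half_strip_def)
  then have strip_image: "(\<lambda>r. (r, 0)) ` {a..b} \<subseteq> half_strip T" by auto
  have pair: "continuous_on {a..b} (\<lambda>r. (r, 0::real))" by (intro continuous_intros)
  have "continuous_on {a..b} (\<lambda>r. u r 0)" "continuous_on {a..b} (\<lambda>r. rho r 0)"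
    using continuous_on_compose2[OF C1_strip_continuous_on(1)[OF C1_u] pair strip_image]
      continuous_on_compose2[OF C1_strip_continuous_on(1)[OF C1_rho] pair strip_image] by simp_all
  then have "continuous_on {a..b} (\<lambda>r. \<bar>u r 0 + \<kappa> * rho r 0\<bar>)"
    by (intro continuous_on_rabs continuous_on_add continuous_on_mult_left)
  moreover have "\<And>r. r \<in> {a..b} \<Longrightarrow> \<bar>u r 0 + \<kappa> * rho r 0\<bar> = \<bar>c2 K 3 rho u r 0\<bar>"
    using strip by (simp add: c2_eq)
  ultimately have "continuous_on {a..b} (\<lambda>r. \<bar>c2 K 3 rho u r 0\<bar>)"
    by (rule continuous_on_eq)
  then show ?thesis
    by (intro bounded_imp_bdd_above compact_imp_bounded compact_continuous_image compact_Icc)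
qed

end

theorem mainTheorem1:
  fixes m :: nat and K T a b :: real
    and rho u xi psi :: "real \<Rightarrow> real \<Rightarrow> real"
  assumes hm: "m \<in> {1, 2}"
    and hK: "0 < K"
    and hT: "0 < T"
    and hab: "0 < a" "a < b"
    and hsol: "radial_euler_solution m K 3 T rho u"
    and hxi: "is_flow a b T (c1 K 3 rho u) xi"
    and hpsi: "is_flow a b T (c2 K 3 rho u) psi"
    and hpos: "\<forall>r \<in> {a..b}. 0 < c1 K 3 rho u r 0"
  shows "\<forall>(r, t) \<in> domain_of_influence a b T xi psi.
           c1 K 3 rho u r t \<ge> (INF r'\<in>{a..b}. c1 K 3 rho u r' 0) \<and>
           c2 K 3 rho u r t \<le> (SUP r'\<in>{a..b}. \<bar>c2 K 3 rho u r' 0\<bar>)"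
proof clarify
  interpret radial_euler_gamma3 m K T rho u
    using hm hK hT hsol by unfold_locales auto
  fix r t assume "(r, t) \<in> domain_of_influence a b T xi psi"
  then obtain r1 r2 where t: "t \<in> {0..T}" and r1: "r1 \<in> {a..b}" and r2: "r2 \<in> {a..b}"
    and r: "psi r1 t = r" "xi r2 t = r"
    by (auto simp: domain_of_influence_def)
  have "(INF r'\<in>{a..b}. c1 K 3 rho u r' 0) \<le> c1 K 3 rho u r2 0"
    using hpos by (intro cINF_lower[OF _ r2] bdd_belowI2[of _ 0]) (auto intro: less_imp_le)
  also have "\<dots> \<le> c1 K 3 rho u r t"
    using c1_ge_initial_along_c1_char[of "xi r2" t] hxi hpos r2 t r(2)
    by (auto simp: is_flow_iff_char_curve)
  finally have c1_bound: "(INF r'\<in>{a..b}. c1 K 3 rho u r' 0) \<le> c1 K 3 rho u r t" .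
  have "c2 K 3 rho u r t \<le> c2 K 3 rho u r1 0"
    using c2_le_initial_on_domain[OF hxi hpsi hpos r1 r2 t] r by simp
  also have "\<dots> \<le> (SUP r'\<in>{a..b}. \<bar>c2 K 3 rho u r' 0\<bar>)"
    using cSUP_upper[OF r1 bdd_above_abs_c2_initial[OF hab(1)]] by linarith
  finally show "(INF r'\<in>{a..b}. c1 K 3 rho u r' 0) \<le> c1 K 3 rho u r t \<and>
      c2 K 3 rho u r t \<le> (SUP r'\<in>{a..b}. \<bar>c2 K 3 rho u r' 0\<bar>)"
    using c1_bound by simp
qed

end
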